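(* Let $(X,\to,0,1)$ be an implicative-orthomodular algebra and let $F$ be a deductive system of $X$. Then $F\in\mathcal{DS}_c(X)$ if and only if $\mathcal{DS}(X/F)=\mathcal{DS}_c(X/F)$; that is, $F$ is commutative if and only if every deductive system of the quotient algebra $X/F$ is commutative.
   Context: A BE algebra is an algebra $(X,\to,1)$ of type $(2,0)$ such that for all $x,y,z\in X$: $x\to x=1$; $x\to 1=1$; $1\to x=x$; $x\to(y\to z)=y\to(x\to z)$. Put $x\le y$ iff $x\to y=1$. It is bounded if there is $0\in X$ with $0\le x$ for all $x\in X$; then $x^*:=x\to 0$. It is involutive if it is bounded and $x^{**}=x$ for all $x$. In an involutive BE algebra $(X,\to,0,1)$ define $x\Cup y:=(x\to y)\to y$, $x\Cap y:=((x^*\to y^* )\to y^* )^*$ and $x\le_Q y$ iff $x=x\Cap y$. An implicative-orthomodular algebra (IOM algebra) is an involutive BE algebra satisfying $x\Cap(y\to x)=x$ for all $x,y\in X$. A deductive system of $X$ is a subset $F\subseteq X$ with $1\in F$ and such that $x,\,x\to y\in F$ implies $y\in F$. A deductive system $F$ is commutative if for all $x,y\in X$, $y\to x\in F$ implies $(x\Cup y)\to x\in F$. $\mathcal{DS}(X)$ is the set of all deductive systems of $X$ and $\mathcal{DS}_c(X)$ the set of all commutative ones. For a deductive system $F$, let $x\equiv_F y$ iff there exists $f\in X$ with $x,y\le_Q f$ and $f\to x,\ f\to y\in F$. This relation is a congruence on $X$ (an equivalence relation compatible with $\to$) whose class of $1$ is $F$; $X/F$ denotes the quotient IOM algebra of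 $X$ by $\equiv_F$, with $x/F$ the class of $x$ and $x/F\to y/F:=(x\to y)/F$. *)

theory Defs
  imports "HOL-Algebra.Congruence"
begin

record 'a bounded_be = "'a partial_object" +
  imp :: "'a \<Rightarrow> 'a \<Rightarrow> 'a"  (infixr "\<leadsto>\<index>" 65)
  be_zero :: 'a  ("\<zero>\<index>")
  be_one :: 'a  ("\<one>\<index>")

locale be_algebra =
  fixes X (structure)
  assumes one_closed: "\<one> \<in> carrier X"
    and imp_closed: "\<lbrakk>x \<in> carrier X; y \<in> carrier X\<rbrakk> \<Longrightarrow> x \<leadsto> y \<in> carrier X"
    and imp_self: "x \<in> carrier X \<Longrightarrow> x \<leadsto> x = \<one>"
    and imp_one: "x \<in> carrier X \<Longrightarrow> x \<leadsto> \<one> = \<one>"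
    and one_imp: "x \<in> carrier X \<Longrightarrow> \<one> \<leadsto> x = x"
    and imp_exchange: "\<lbrakk>x \<in> carrier X; y \<in> carrier X; z \<in> carrier X\<rbrakk>
      \<Longrightarrow> x \<leadsto> (y \<leadsto> z) = y \<leadsto> (x \<leadsto> z)"

definition be_le :: "('a, 'm) bounded_be_scheme \<Rightarrow> 'a \<Rightarrow> 'a \<Rightarrow> bool"  (infix "\<preceq>\<index>" 50)
  where "x \<preceq>\<^bsub>X\<^esub> y \<longleftrightarrow> x \<leadsto>\<^bsub>X\<^esub> y = \<one>\<^bsub>X\<^esub>"

definition be_neg :: "('a, 'm) bounded_be_scheme \<Rightarrow> 'a \<Rightarrow> 'a"  ("\<sim>\<index> _" [81] 80)
  where "\<sim>\<^bsub>X\<^esub> x = x \<leadsto>\<^bsub>X\<^esub> \<zero>\<^bsub>X\<^esub>"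

definition q_join :: "('a, 'm) bounded_be_scheme \<Rightarrow> 'a \<Rightarrow> 'a \<Rightarrow> 'a"  (infixl "\<Cup>\<index>" 70)
  where "x \<Cup>\<^bsub>X\<^esub> y = (x \<leadsto>\<^bsub>X\<^esub> y) \<leadsto>\<^bsub>X\<^esub> y"

definition q_meet :: "('a, 'm) bounded_be_scheme \<Rightarrow> 'a \<Rightarrow> 'a \<Rightarrow> 'a"  (infixl "\<Cap>\<index>" 70)
  where "x \<Cap>\<^bsub>X\<^esub> y =
    \<sim>\<^bsub>X\<^esub> ((\<sim>\<^bsub>X\<^esub> x \<leadsto>\<^bsub>X\<^esub> \<sim>\<^bsub>X\<^esub> y) \<leadsto>\<^bsub>X\<^esub> \<sim>\<^bsub>X\<^esub> y)"

definition q_le :: "('a, 'm) bounded_be_scheme \<Rightarrow> 'a \<Rightarrow> 'a \<Rightarrow> bool"  (infix "\<preceq>\<^sub>Q\<index>" 50)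
  where "x \<preceq>\<^sub>Q\<^bsub>X\<^esub> y \<longleftrightarrow> x = x \<Cap>\<^bsub>X\<^esub> y"

locale bounded_be_algebra = be_algebra +
  assumes zero_closed: "\<zero> \<in> carrier X"
    and zero_le: "x \<in> carrier X \<Longrightarrow> \<zero> \<preceq> x"

locale involutive_be_algebra = bounded_be_algebra +
  assumes neg_neg: "x \<in> carrier X \<Longrightarrow> \<sim> (\<sim> x) = x"

locale iom_algebra = involutive_be_algebra +
  assumes meet_imp: "\<lbrakk>x \<in> carrier X; y \<in> carrier X\<rbrakk> \<Longrightarrow> x \<Cap> (y \<leadsto> x) = x"

definition deductive_system :: "('a, 'm) bounded_be_scheme \<Rightarrow> 'a set \<Rightarrow> bool"
  where "deductive_system X F \<longleftrightarrow>
    F \<subseteq> carrier X \<and> \<one>\<^bsub>X\<^esub> \<in> F \<and>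
    (\<forall>x\<in>carrier X. \<forall>y\<in>carrier X. x \<in> F \<and> x \<leadsto>\<^bsub>X\<^esub> y \<in> F \<longrightarrow> y \<in> F)"

definition commutative_ds :: "('a, 'm) bounded_be_scheme \<Rightarrow> 'a set \<Rightarrow> bool"
  where "commutative_ds X F \<longleftrightarrow>
    deductive_system X F \<and>
    (\<forall>x\<in>carrier X. \<forall>y\<in>carrier X. y \<leadsto>\<^bsub>X\<^esub> x \<in> F \<longrightarrow> (x \<Cup>\<^bsub>X\<^esub> y) \<leadsto>\<^bsub>X\<^esub> x \<in> F)"

definition DS :: "('a, 'm) bounded_be_scheme \<Rightarrow> 'a set set"
  where "DS X = {F. deductive_system X F}"

definition DS\<^sub>c :: "('a, 'm) bounded_be_scheme \<Rightarrow> 'a set set"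
  where "DS\<^sub>c X = {F. commutative_ds X F}"

definition ds_cong :: "('a, 'm) bounded_be_scheme \<Rightarrow> 'a set \<Rightarrow> ('a \<times> 'a) set"
  where "ds_cong X F = {(x, y). x \<in> carrier X \<and> y \<in> carrier X \<and>
    (\<exists>f\<in>carrier X. x \<preceq>\<^sub>Q\<^bsub>X\<^esub> f \<and> y \<preceq>\<^sub>Q\<^bsub>X\<^esub> f \<and> f \<leadsto>\<^bsub>X\<^esub> x \<in> F \<and> f \<leadsto>\<^bsub>X\<^esub> y \<in> F)}"

text \<open>
  The operation on classes is the usual lifting along an equivalence relation: when the relation
  is a congruence, all the sets in the union are equal to the class of \<open>x \<leadsto> y\<close> for any choice of
  representatives \<open>x\<close> of \<open>A\<close> and \<open>y\<close> of \<open>B\<close>.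
\<close>
definition quotient_algebra :: "('a, 'm) bounded_be_scheme \<Rightarrow> 'a set \<Rightarrow> 'a set bounded_be"
  (infixl "\<sslash>" 75)
  where "X \<sslash> F =
    \<lparr> carrier = carrier X // ds_cong X F,
      imp = (\<lambda>A B. \<Union>x\<in>A. \<Union>y\<in>B. ds_cong X F `` {x \<leadsto>\<^bsub>X\<^esub> y}),
      be_zero = ds_cong X F `` {\<zero>\<^bsub>X\<^esub>},
      be_one = ds_cong X F `` {\<one>\<^bsub>X\<^esub>} \<rparr>"

end

theory Submission
  imports Defs
begin

text \<open>
  The equivalence compares commutativity of one deductive system with commutativity of all the
  deductive systems above it. One direction reads off the smallest deductive system of the quotient:
  \<open>{1/F}\<close> is always a deductive system there, and its being commutative says exactly that \<open>F\<close>
  is (lemma \<open>commutative_if_quotient_unit_commutative\<close>).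

  For the other direction, a deductive system of the quotient pulls back to a deductive system
  \<open>G \<supseteq> F\<close>, and it suffices that commutativity passes from \<open>F\<close> to \<open>G\<close> (lemma
  \<open>commutative_extension\<close>). Given \<open>u = y \<leadsto> x \<in> G\<close>, put \<open>x' = u \<leadsto> x\<close>. Then \<open>y \<leadsto> x' = \<one> \<in> F\<close>,
  so \<open>(x' \<Cup> y) \<leadsto> x' \<in> F\<close>, and exchanging premises gives \<open>u \<leadsto> ((x' \<Cup> y) \<leadsto> x) \<in> F \<subseteq> G\<close>; detaching \<open>u\<close>
  and using that \<open>x \<Cup> y\<close> lies below \<open>x' \<Cup> y\<close> yields \<open>(x \<Cup> y) \<leadsto> x \<in> G\<close>.

  Both directions rest on the relation defining the quotient being a congruence whose class of
  \<open>\<one>\<close> is \<open>F\<close>. This becomes transparent in terms of the fusion \<open>x \<odot> y = \<sim>(x \<leadsto> \<sim>y)\<close>, a commutative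
  monoid operation for which \<open>\<leadsto>\<close> is adjoint in the sense that \<open>(x \<odot> y) \<leadsto> z = x \<leadsto> (y \<leadsto> z)\<close>. The
  orthomodular axiom ensures that \<open>x \<preceq>\<^sub>Q y\<close> holds exactly when \<open>x\<close> is a multiple of \<open>y\<close>
  and that negation reverses this divisibility order. A deductive system is closed under fusion, and
  two elements are congruent exactly when they have a common multiple with cofactors in \<open>F\<close>
  (lemma \<open>ds_cong_iff_common_multiple\<close>). In this form transitivity and compatibility with fusion are
  immediate, while the original form, a common divisor, turns under negation into a common
  multiple, which gives compatibility with negation.
\<close>

section \<open>Fusion and the divisibility order\<close>

definition fusion :: "('a, 'm) bounded_be_scheme \<Rightarrow> 'a \<Rightarrow> 'a \<Rightarrow> 'a"  (infixl "\<odot>\<index>" 70)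
  where "x \<odot>\<^bsub>X\<^esub> y = \<sim>\<^bsub>X\<^esub> (x \<leadsto>\<^bsub>X\<^esub> \<sim>\<^bsub>X\<^esub> y)"

context be_algebra
begin

lemma le_join: "\<lbrakk>x \<in> carrier X; y \<in> carrier X\<rbrakk> \<Longrightarrow> x \<leadsto> (x \<Cup> y) = \<one>"
  unfolding q_join_def by (simp add: imp_exchange[of x "x \<leadsto> y" y] imp_self imp_closed)

end

context involutive_be_algebra
begin

lemma neg_closed: "x \<in> carrier X \<Longrightarrow> \<sim> x \<in> carrier X"
  unfolding be_neg_def by (simp add: imp_closed zero_closed)

lemma fusion_closed: "\<lbrakk>x \<in> carrier X; y \<in> carrier X\<rbrakk> \<Longrightarrow> x \<odot> y \<in> carrier X"
  unfolding fusion_def by (simp add: neg_closed imp_closed)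

lemmas closed = one_closed imp_closed neg_closed fusion_closed

lemma imp_neg_swap:
  assumes "x \<in> carrier X" "y \<in> carrier X"
  shows "x \<leadsto> \<sim> y = y \<leadsto> \<sim> x"
  unfolding be_neg_def using assms by (simp add: imp_exchange zero_closed)

lemma contraposition:
  assumes "x \<in> carrier X" "y \<in> carrier X"
  shows "\<sim> y \<leadsto> \<sim> x = x \<leadsto> y"
  using imp_neg_swap[of x "\<sim> y"] assms by (simp add: neg_closed neg_neg)

lemma fusion_commute:
  assumes "x \<in> carrier X" "y \<in> carrier X"
  shows "x \<odot> y = y \<odot> x"
  unfolding fusion_def using imp_neg_swap[OF assms] by simp

lemma fusion_imp:
  assumes "x \<in> carrier X" "y \<in> carrier X" "z \<in> carrier X"
  shows "(x \<odot> y) \<leadsto> z = x \<leadsto> (y \<leadsto> z)"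
proof -
  have "(x \<odot> y) \<leadsto> z = \<sim> z \<leadsto> (x \<leadsto> \<sim> y)"
    using contraposition[of "x \<odot> y" z] assms
    by (simp add: fusion_def neg_neg closed)
  also have "\<dots> = x \<leadsto> (\<sim> z \<leadsto> \<sim> y)"
    using assms by (simp add: imp_exchange closed)
  also have "\<dots> = x \<leadsto> (y \<leadsto> z)"
    using assms by (simp add: contraposition)
  finally show ?thesis .
qed

lemma fusion_assoc:
  assumes "x \<in> carrier X" "y \<in> carrier X" "z \<in> carrier X"
  shows "(x \<odot> y) \<odot> z = x \<odot> (y \<odot> z)"
proof -
  have "(x \<odot> y) \<odot> z = \<sim> (x \<leadsto> (y \<leadsto> \<sim> z))"
    using assms by (simp add: fusion_def[of X "x \<odot> y"] fusion_imp closed)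
  also have "\<dots> = x \<odot> (y \<odot> z)"
    using assms by (simp add: fusion_def neg_neg closed)
  finally show ?thesis .
qed

lemma fusion_left_commute:
  assumes "x \<in> carrier X" "y \<in> carrier X" "z \<in> carrier X"
  shows "x \<odot> (y \<odot> z) = y \<odot> (x \<odot> z)"
  using assms by (metis fusion_assoc fusion_commute)

lemma fusion_one:
  assumes "x \<in> carrier X"
  shows "x \<odot> \<one> = x"
  unfolding fusion_commute[OF assms one_closed]
  using assms by (simp add: fusion_def one_imp neg_closed neg_neg)

lemma imp_as_fusion: "\<lbrakk>x \<in> carrier X; y \<in> carrier X\<rbrakk> \<Longrightarrow> x \<leadsto> y = \<sim> (x \<odot> \<sim> y)"
  unfolding fusion_def by (simp add: neg_neg closed)

lemma meet_as_fusion: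
  assumes "x \<in> carrier X" "y \<in> carrier X"
  shows "x \<Cap> y = y \<odot> (y \<leadsto> x)"
proof -
  have "x \<Cap> y = (y \<leadsto> x) \<odot> y"
    unfolding q_meet_def fusion_def using assms by (simp add: contraposition)
  then show ?thesis
    using assms by (simp add: fusion_commute closed)
qed

lemma q_le_iff:
  assumes "x \<in> carrier X" "y \<in> carrier X"
  shows "x \<preceq>\<^sub>Q y \<longleftrightarrow> y \<odot> (y \<leadsto> x) = x"
  unfolding q_le_def using assms by (auto simp: meet_as_fusion)

lemma q_le_imp_le:
  assumes "x \<in> carrier X" "y \<in> carrier X" "x \<preceq>\<^sub>Q y"
  shows "x \<leadsto> y = \<one>"
proof -
  have "(y \<odot> (y \<leadsto> x)) \<leadsto> y = \<one>"
    using assms by (simp add: fusion_imp imp_exchange[of y "y \<leadsto> x" y] imp_self imp_one closed)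
  then show ?thesis
    using assms q_le_iff by simp
qed

end

context iom_algebra
begin

lemma q_le_imp_self: "\<lbrakk>x \<in> carrier X; c \<in> carrier X\<rbrakk> \<Longrightarrow> x \<preceq>\<^sub>Q c \<leadsto> x"
  unfolding q_le_def by (simp add: meet_imp)

text \<open>
  The orthomodular axiom for \<open>\<sim> y\<close>, read through negation: since \<open>\<sim> (y \<odot> c) = c \<leadsto> \<sim> y\<close>, it
  recovers a divisor \<open>y\<close> from any of its multiples.
\<close>
lemma join_multiple:
  assumes "y \<in> carrier X" "c \<in> carrier X"
  shows "y \<Cup> (y \<odot> c) = y"
proof -
  let ?w = "y \<odot> c"
  have w: "?w \<in> carrier X" using assms by (simp add: closed)
  have "c \<leadsto> \<sim> y = \<sim> ?w"
    using assms by (simp add: fusion_def neg_neg closed imp_neg_swap[of c y])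
  then have "\<sim> ?w \<odot> (\<sim> ?w \<leadsto> \<sim> y) = \<sim> y"
    using q_le_imp_self[of "\<sim> y" c] assms w by (simp add: q_le_iff closed)
  then have "\<sim> ((y \<leadsto> ?w) \<odot> \<sim> ?w) = \<sim> (\<sim> y)"
    using assms w by (simp add: contraposition fusion_commute closed)
  then show ?thesis
    unfolding q_join_def using assms w
    by (simp add: imp_as_fusion[of "y \<leadsto> ?w" ?w] neg_neg closed)
qed

lemma q_le_join:
  assumes "x \<in> carrier X" "y \<in> carrier X" "x \<preceq>\<^sub>Q y"
  shows "(y \<leadsto> x) \<leadsto> x = y"
  using join_multiple[of y "y \<leadsto> x"] assms by (simp add: q_le_iff q_join_def closed)

lemma fusion_q_le:
  assumes "y \<in> carrier X" "c \<in> carrier X"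
  shows "y \<odot> c \<preceq>\<^sub>Q y"
  using q_le_imp_self[of "y \<odot> c" "y \<leadsto> (y \<odot> c)"] join_multiple[OF assms] assms
  by (simp add: q_join_def closed)

lemma imp_antimono:
  assumes "x \<in> carrier X" "x' \<in> carrier X" "y \<in> carrier X" "x \<preceq>\<^sub>Q x'"
  shows "x' \<leadsto> y \<preceq>\<^sub>Q x \<leadsto> y"
proof -
  have "x \<leadsto> y = ((x' \<leadsto> x) \<odot> x') \<leadsto> y"
    using assms by (simp add: q_le_iff fusion_commute closed)
  also have "\<dots> = (x' \<leadsto> x) \<leadsto> (x' \<leadsto> y)"
    using assms by (simp add: fusion_imp closed)
  finally show ?thesis
    using q_le_imp_self[of "x' \<leadsto> y" "x' \<leadsto> x"] assms by (simp add: closed)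
qed

text \<open>
  Negation turns the multiple \<open>x\<close> of \<open>f\<close> into a divisor of \<open>\<sim> f\<close>, and does so without changing the
  cofactor \<open>f \<leadsto> x\<close>. This is why the congruence of a deductive system respects negation.
\<close>
lemma neg_fusion_cofactor:
  assumes "x \<in> carrier X" "f \<in> carrier X" "x \<preceq>\<^sub>Q f"
  shows "\<sim> x \<odot> (f \<leadsto> x) = \<sim> f"
proof -
  have "\<sim> x \<odot> (f \<leadsto> x) = \<sim> ((f \<leadsto> x) \<leadsto> x)"
    using assms by (simp add: imp_as_fusion[of "f \<leadsto> x"] neg_neg fusion_commute closed)
  then show ?thesis
    using assms by (simp add: q_le_join)
qed

end

section \<open>Deductive systems and commutativity\<close>

context iom_algebra
begin

lemma ds_carrier: "\<lbrakk>deductive_system X F; x \<in> F\<rbrakk> \<Longrightarrow> x \<in> carrier X"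
  unfolding deductive_system_def by blast

lemma ds_one: "deductive_system X F \<Longrightarrow> \<one> \<in> F"
  unfolding deductive_system_def by blast

lemma ds_detach: "\<lbrakk>deductive_system X F; x \<in> F; x \<leadsto> y \<in> F; y \<in> carrier X\<rbrakk> \<Longrightarrow> y \<in> F"
  unfolding deductive_system_def by blast

lemma ds_upward: "\<lbrakk>deductive_system X F; x \<in> F; x \<leadsto> y = \<one>; y \<in> carrier X\<rbrakk> \<Longrightarrow> y \<in> F"
  by (metis ds_detach ds_one)

text \<open>
  Currying \<open>(x \<odot> y) \<leadsto> (x \<odot> y) = \<one>\<close> gives \<open>x \<leadsto> (y \<leadsto> (x \<odot> y)) = \<one>\<close>. Detaching \<open>x\<close> and \<open>y\<close>
  from it proves closure under fusion; detaching \<open>x\<close> alone shows that cofactors of multiples by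
  elements of the system stay in the system.
\<close>
lemma ds_cofactor:
  assumes F: "deductive_system X F" and x: "x \<in> F" and y: "y \<in> carrier X"
  shows "y \<leadsto> (y \<odot> x) \<in> F"
proof -
  have xc: "x \<in> carrier X" using F x by (rule ds_carrier)
  have "x \<leadsto> (y \<leadsto> (y \<odot> x)) = (y \<odot> x) \<leadsto> (y \<odot> x)"
    using xc y by (simp add: fusion_imp imp_exchange closed)
  then show ?thesis
    using ds_upward[OF F x] xc y by (simp add: imp_self closed)
qed

lemma ds_fusion:
  assumes F: "deductive_system X F" and "x \<in> F" "y \<in> F"
  shows "x \<odot> y \<in> F"
  using ds_cofactor[OF F \<open>y \<in> F\<close>, of x] ds_detach[OF F \<open>x \<in> F\<close>] assms
  by (simp add: ds_carrier closed)

text \<open>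
  Replacing \<open>x\<close> by \<open>x' = (y \<leadsto> x) \<leadsto> x\<close> makes the hypothesis of commutativity hold outright, so that the
  commutativity of the small system \<open>F\<close> applies. The step back from \<open>x'\<close> to \<open>x\<close> uses \<open>x \<preceq>\<^sub>Q x'\<close>: the
  operation \<open>\<leadsto>\<close> reverses the order in its first argument, and this is applied three times.
\<close>
lemma commutative_extension:
  assumes F: "commutative_ds X F" and G: "deductive_system X G" and FG: "F \<subseteq> G"
  shows "commutative_ds X G"
  unfolding commutative_ds_def
proof (intro conjI ballI impI)
  show "deductive_system X G" by (rule G)
next
  fix x y assume x: "x \<in> carrier X" and y: "y \<in> carrier X" and u: "y \<leadsto> x \<in> G"
  let ?u = "y \<leadsto> x"
  let ?x' = "?u \<leadsto> x"
  have "y \<leadsto> ?x' = \<one>"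
    using le_join[OF y x] by (simp add: q_join_def)
  then have "(?x' \<Cup> y) \<leadsto> ?x' \<in> F"
    using F x y ds_one[of F] by (simp add: commutative_ds_def closed)
  moreover have "(?x' \<Cup> y) \<leadsto> ?x' = ?u \<leadsto> ((?x' \<Cup> y) \<leadsto> x)"
    using x y by (simp add: q_join_def imp_exchange closed)
  ultimately have lower: "(?x' \<Cup> y) \<leadsto> x \<in> G"
    using ds_detach[OF G u] FG x y by (auto simp: q_join_def closed)
  have "x \<preceq>\<^sub>Q ?x'"
    using x y by (simp add: q_le_imp_self closed)
  then have "x \<Cup> y \<preceq>\<^sub>Q ?x' \<Cup> y"
    unfolding q_join_def using x y by (simp add: imp_antimono closed)
  then have "(?x' \<Cup> y) \<leadsto> x \<preceq>\<^sub>Q (x \<Cup> y) \<leadsto> x"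
    using x y by (simp add: imp_antimono q_join_def closed)
  then show "(x \<Cup> y) \<leadsto> x \<in> G"
    using ds_upward[OF G lower] q_le_imp_le x y by (simp add: q_join_def closed)
qed

end

section \<open>The congruence of a deductive system\<close>

locale iom_deductive_system = iom_algebra +
  fixes F
  assumes ds: "deductive_system X F"
begin

lemma in_carrier: "x \<in> F \<Longrightarrow> x \<in> carrier X"
  using ds by (rule ds_carrier)

text \<open>
  The defining condition asks for a common divisor \<open>f\<close> of \<open>x\<close> and \<open>y\<close> with cofactors in \<open>F\<close>. Multiplying
  by the two cofactors gives a common multiple of this kind. Conversely, a common multiple \<open>w\<close> satisfies
  \<open>x = (x \<leadsto> w) \<leadsto> w\<close> and \<open>y = (y \<leadsto> w) \<leadsto> w\<close>, so by exchange \<open>f = (y \<leadsto> w) \<leadsto> ((x \<leadsto> w) \<leadsto> w)\<close> equals both \<open>(y \<leadsto> w) \<leadsto> x\<close> and \<open>(x \<leadsto> w) \<leadsto> y\<close>. It is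
  therefore a common divisor, and its cofactors \<open>f \<leadsto> x\<close> and \<open>f \<leadsto> y\<close> lie above the elements \<open>y \<leadsto> w\<close> and
  \<open>x \<leadsto> w\<close> of \<open>F\<close>.
\<close>
lemma ds_cong_iff_common_multiple:
  "(x, y) \<in> ds_cong X F \<longleftrightarrow>
    x \<in> carrier X \<and> y \<in> carrier X \<and> (\<exists>p\<in>F. \<exists>q\<in>F. x \<odot> p = y \<odot> q)"
proof
  assume "(x, y) \<in> ds_cong X F"
  then obtain f where xy: "x \<in> carrier X" "y \<in> carrier X" and f: "f \<in> carrier X"
    and div: "x \<preceq>\<^sub>Q f" "y \<preceq>\<^sub>Q f" and inF: "f \<leadsto> x \<in> F" "f \<leadsto> y \<in> F"
    unfolding ds_cong_def by blast
  have "x \<odot> (f \<leadsto> y) = (f \<odot> (f \<leadsto> x)) \<odot> (f \<leadsto> y)"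
    using div xy f by (simp add: q_le_iff)
  also have "\<dots> = (f \<odot> (f \<leadsto> y)) \<odot> (f \<leadsto> x)"
    using xy f by (simp add: fusion_assoc fusion_commute[of "f \<leadsto> x"] closed)
  also have "\<dots> = y \<odot> (f \<leadsto> x)"
    using div xy f by (simp add: q_le_iff)
  finally show "x \<in> carrier X \<and> y \<in> carrier X \<and> (\<exists>p\<in>F. \<exists>q\<in>F. x \<odot> p = y \<odot> q)"
    using xy inF by blast
next
  assume "x \<in> carrier X \<and> y \<in> carrier X \<and> (\<exists>p\<in>F. \<exists>q\<in>F. x \<odot> p = y \<odot> q)"
  then obtain p q where xy: "x \<in> carrier X" "y \<in> carrier X" and pq: "p \<in> F" "q \<in> F"
    and eq: "x \<odot> p = y \<odot> q"
    by blast
  define w where "w = x \<odot> p"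
  have w: "w \<in> carrier X" and pqc: "p \<in> carrier X" "q \<in> carrier X"
    using xy pq by (auto simp: w_def in_carrier closed)
  have wF: "x \<leadsto> w \<in> F" "y \<leadsto> w \<in> F"
    using ds_cofactor[OF ds pq(1) xy(1)] ds_cofactor[OF ds pq(2) xy(2)]
    unfolding w_def eq by blast+
  have "(x \<leadsto> w) \<leadsto> w = x" "(y \<leadsto> w) \<leadsto> w = y"
    using join_multiple[of x p] join_multiple[of y q] xy pqc eq
    by (auto simp: w_def q_join_def)
  then have f_eq: "(y \<leadsto> w) \<leadsto> x = (x \<leadsto> w) \<leadsto> y"
    using imp_exchange[of "y \<leadsto> w" "x \<leadsto> w" w] xy w by (simp add: closed)
  let ?f = "(y \<leadsto> w) \<leadsto> x"
  have "x \<preceq>\<^sub>Q ?f" "y \<preceq>\<^sub>Q ?f"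
    using q_le_imp_self[of x "y \<leadsto> w"] q_le_imp_self[of y "x \<leadsto> w"] xy w f_eq
    by (auto simp: closed)
  moreover have "?f \<leadsto> x \<in> F"
    using ds_upward[OF ds wF(2)] le_join[of "y \<leadsto> w" x] xy w by (simp add: q_join_def closed)
  moreover have "?f \<leadsto> y \<in> F"
    unfolding f_eq
    using ds_upward[OF ds wF(1)] le_join[of "x \<leadsto> w" y] xy w by (simp add: q_join_def closed)
  moreover have "?f \<in> carrier X" using xy w by (simp add: closed)
  ultimately show "(x, y) \<in> ds_cong X F"
    unfolding ds_cong_def using xy by blast
qed

lemma ds_cong_equiv: "equiv (carrier X) (ds_cong X F)"
proof (rule equivI)
  show "ds_cong X F \<subseteq> carrier X \<times> carrier X"
    unfolding ds_cong_def by blast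
  show "refl_on (carrier X) (ds_cong X F)"
    unfolding refl_on_def ds_cong_iff_common_multiple using ds_one[OF ds] by auto
  show "sym (ds_cong X F)"
    unfolding sym_def ds_cong_iff_common_multiple by metis
  show "trans (ds_cong X F)"
  proof (rule transI)
    fix x y z assume "(x, y) \<in> ds_cong X F" "(y, z) \<in> ds_cong X F"
    then obtain p q r s where c: "x \<in> carrier X" "y \<in> carrier X" "z \<in> carrier X"
      and F: "p \<in> F" "q \<in> F" "r \<in> F" "s \<in> F" and eq: "x \<odot> p = y \<odot> q" "y \<odot> r = z \<odot> s"
      unfolding ds_cong_iff_common_multiple by blast
    have "x \<odot> (p \<odot> r) = (y \<odot> q) \<odot> r"
      using c F by (simp add: fusion_assoc[symmetric] eq(1) in_carrier)
    also have "\<dots> = (y \<odot> r) \<odot> q"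
      using c F by (simp add: fusion_assoc fusion_commute[of q r] in_carrier)
    also have "\<dots> = z \<odot> (s \<odot> q)"
      using c F by (simp add: eq(2) fusion_assoc in_carrier)
    finally show "(x, z) \<in> ds_cong X F"
      unfolding ds_cong_iff_common_multiple using c F ds_fusion[OF ds] by blast
  qed
qed

lemma ds_cong_neg:
  assumes "(x, y) \<in> ds_cong X F"
  shows "(\<sim> x, \<sim> y) \<in> ds_cong X F"
proof -
  obtain f where c: "x \<in> carrier X" "y \<in> carrier X" "f \<in> carrier X"
    and div: "x \<preceq>\<^sub>Q f" "y \<preceq>\<^sub>Q f" and inF: "f \<leadsto> x \<in> F" "f \<leadsto> y \<in> F"
    using assms unfolding ds_cong_def by blast
  have "\<sim> x \<odot> (f \<leadsto> x) = \<sim> y \<odot> (f \<leadsto> y)"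
    using c div by (simp add: neg_fusion_cofactor)
  then show ?thesis
    unfolding ds_cong_iff_common_multiple using c inF neg_closed by blast
qed

lemma ds_cong_fusion:
  assumes "(x, x') \<in> ds_cong X F" "(y, y') \<in> ds_cong X F"
  shows "(x \<odot> y, x' \<odot> y') \<in> ds_cong X F"
proof -
  obtain p q r s where c: "x \<in> carrier X" "x' \<in> carrier X" "y \<in> carrier X" "y' \<in> carrier X"
    and F: "p \<in> F" "q \<in> F" "r \<in> F" "s \<in> F" and eq: "x \<odot> p = x' \<odot> q" "y \<odot> r = y' \<odot> s"
    using assms unfolding ds_cong_iff_common_multiple by blast
  have swap: "(a \<odot> b) \<odot> (d \<odot> e) = (a \<odot> d) \<odot> (b \<odot> e)"
    if "a \<in> carrier X" "b \<in> carrier X" "d \<in> carrier X" "e \<in> carrier X" for a b d e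
    using that by (simp add: fusion_assoc fusion_left_commute[of b d e] closed)
  have "(x \<odot> y) \<odot> (p \<odot> r) = (x' \<odot> y') \<odot> (q \<odot> s)"
    using c F by (simp add: swap[of x y] swap[of x' y'] eq in_carrier)
  then show ?thesis
    unfolding ds_cong_iff_common_multiple using c F ds_fusion[OF ds] fusion_closed by blast
qed

lemma ds_cong_imp:
  assumes "(x, x') \<in> ds_cong X F" "(y, y') \<in> ds_cong X F"
  shows "(x \<leadsto> y, x' \<leadsto> y') \<in> ds_cong X F"
proof -
  have "x \<in> carrier X" "x' \<in> carrier X" "y \<in> carrier X" "y' \<in> carrier X"
    using assms unfolding ds_cong_def by auto
  then show ?thesis
    using ds_cong_neg[OF ds_cong_fusion[OF assms(1) ds_cong_neg[OF assms(2)]]]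
    by (simp add: imp_as_fusion)
qed

lemma ds_cong_one_iff: "(x, \<one>) \<in> ds_cong X F \<longleftrightarrow> x \<in> F"
proof
  assume "(x, \<one>) \<in> ds_cong X F"
  then obtain p q where x: "x \<in> carrier X" and pq: "p \<in> F" "q \<in> F" and eq: "x \<odot> p = \<one> \<odot> q"
    unfolding ds_cong_iff_common_multiple by blast
  then have q: "q = x \<odot> p"
    using fusion_one[of q] fusion_commute[of q \<one>] by (simp add: in_carrier one_closed)
  then have "q \<leadsto> x = \<one>"
    using q_le_imp_le[OF _ x fusion_q_le[OF x]] x pq by (simp add: in_carrier fusion_closed)
  then show "x \<in> F"
    using ds_upward[OF ds pq(2)] x by blast
next
  assume x: "x \<in> F"
  then have "x \<odot> \<one> = \<one> \<odot> x"
    by (simp add: fusion_commute in_carrier one_closed)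
  then show "(x, \<one>) \<in> ds_cong X F"
    unfolding ds_cong_iff_common_multiple using x ds_one[OF ds] in_carrier one_closed by blast
qed

section \<open>The quotient\<close>

abbreviation cls :: "'a \<Rightarrow> 'a set"
  where "cls x \<equiv> ds_cong X F `` {x}"

lemma quotient_carrier: "carrier (X \<sslash> F) = cls ` carrier X"
  unfolding quotient_algebra_def quotient_def by auto

lemma quotient_one: "\<one>\<^bsub>X \<sslash> F\<^esub> = cls \<one>"
  unfolding quotient_algebra_def by simp

lemma cls_eq_iff:
  assumes "x \<in> carrier X" "y \<in> carrier X"
  shows "cls x = cls y \<longleftrightarrow> (x, y) \<in> ds_cong X F"
  using eq_equiv_class_iff[OF ds_cong_equiv assms] .

lemma quotient_imp:
  assumes "x \<in> carrier X" "y \<in> carrier X"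
  shows "cls x \<leadsto>\<^bsub>X \<sslash> F\<^esub> cls y = cls (x \<leadsto> y)"
proof -
  have "congruent2 (ds_cong X F) (ds_cong X F) (\<lambda>x y. cls (x \<leadsto> y))"
    unfolding congruent2_def using equiv_class_eq[OF ds_cong_equiv ds_cong_imp] by blast
  then show ?thesis
    unfolding quotient_algebra_def
    using UN_equiv_class2[OF ds_cong_equiv ds_cong_equiv] assms by simp
qed

lemma quotient_join:
  assumes "x \<in> carrier X" "y \<in> carrier X"
  shows "cls x \<Cup>\<^bsub>X \<sslash> F\<^esub> cls y = cls (x \<Cup> y)"
  unfolding q_join_def using assms by (simp add: quotient_imp closed)

lemma cls_eq_one_iff: "x \<in> carrier X \<Longrightarrow> cls x = \<one>\<^bsub>X \<sslash> F\<^esub> \<longleftrightarrow> x \<in> F"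
  by (simp add: quotient_one cls_eq_iff one_closed ds_cong_one_iff)

lemma quotient_unit_ds: "deductive_system (X \<sslash> F) {\<one>\<^bsub>X \<sslash> F\<^esub>}"
  unfolding deductive_system_def quotient_carrier
  using quotient_imp[OF one_closed] by (auto simp: quotient_one one_closed one_imp)

lemma commutative_if_quotient_unit_commutative:
  assumes "commutative_ds (X \<sslash> F) {\<one>\<^bsub>X \<sslash> F\<^esub>}"
  shows "commutative_ds X F"
  unfolding commutative_ds_def
proof (intro conjI ballI impI)
  show "deductive_system X F" by (rule ds)
next
  fix x y assume x: "x \<in> carrier X" and y: "y \<in> carrier X" and "y \<leadsto> x \<in> F"
  then have "cls y \<leadsto>\<^bsub>X \<sslash> F\<^esub> cls x = \<one>\<^bsub>X \<sslash> F\<^esub>"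
    by (simp add: quotient_imp cls_eq_one_iff closed)
  then have "(cls x \<Cup>\<^bsub>X \<sslash> F\<^esub> cls y) \<leadsto>\<^bsub>X \<sslash> F\<^esub> cls x = \<one>\<^bsub>X \<sslash> F\<^esub>"
    using assms x y unfolding commutative_ds_def quotient_carrier by simp
  then show "(x \<Cup> y) \<leadsto> x \<in> F"
    using x y cls_eq_one_iff[of "(x \<Cup> y) \<leadsto> x"]
    by (simp add: quotient_join quotient_imp q_join_def closed)
qed

lemma pullback_ds:
  assumes G: "deductive_system (X \<sslash> F) G"
  shows "deductive_system X {x \<in> carrier X. cls x \<in> G}"
  unfolding deductive_system_def
proof (intro conjI ballI impI)
  have "cls \<one> \<in> G"
    using G unfolding deductive_system_def quotient_one by blast
  then show "\<one> \<in> {x \<in> carrier X. cls x \<in> G}"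
    using one_closed by blast
next
  fix x y assume xy: "x \<in> carrier X" "y \<in> carrier X"
    and mem: "x \<in> {x \<in> carrier X. cls x \<in> G} \<and> x \<leadsto> y \<in> {x \<in> carrier X. cls x \<in> G}"
  have "cls x \<in> G" "cls x \<leadsto>\<^bsub>X \<sslash> F\<^esub> cls y \<in> G"
    using mem quotient_imp[OF xy] by auto
  moreover have "cls x \<in> carrier (X \<sslash> F)" "cls y \<in> carrier (X \<sslash> F)"
    using xy unfolding quotient_carrier by blast+
  ultimately show "y \<in> {x \<in> carrier X. cls x \<in> G}"
    using G xy unfolding deductive_system_def by blast
qed blast

lemma quotient_ds_commutative:
  assumes F: "commutative_ds X F" and G: "deductive_system (X \<sslash> F) G"
  shows "commutative_ds (X \<sslash> F) G"
proof -
  let ?G = "{x \<in> carrier X. cls x \<in> G}"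
  have "\<one>\<^bsub>X \<sslash> F\<^esub> \<in> G"
    using G unfolding deductive_system_def by blast
  then have "F \<subseteq> ?G"
    using cls_eq_one_iff in_carrier by (metis (no_types, lifting) mem_Collect_eq subsetI)
  then have "commutative_ds X ?G"
    using commutative_extension[OF F pullback_ds[OF G]] by blast
  then have lift: "cls ((x \<Cup> y) \<leadsto> x) \<in> G"
    if "x \<in> carrier X" "y \<in> carrier X" "cls (y \<leadsto> x) \<in> G" for x y
    using that imp_closed unfolding commutative_ds_def by blast
  show ?thesis
    unfolding commutative_ds_def
  proof (intro conjI ballI impI)
    show "deductive_system (X \<sslash> F) G" by (rule G)
  next
    fix A B assume "A \<in> carrier (X \<sslash> F)" "B \<in> carrier (X \<sslash> F)"
      and BA: "B \<leadsto>\<^bsub>X \<sslash> F\<^esub> A \<in> G"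
    then obtain x y where xy: "x \<in> carrier X" "y \<in> carrier X" and AB: "A = cls x" "B = cls y"
      unfolding quotient_carrier by blast
    have "x \<Cup> y \<in> carrier X"
      using xy by (simp add: q_join_def closed)
    then show "(A \<Cup>\<^bsub>X \<sslash> F\<^esub> B) \<leadsto>\<^bsub>X \<sslash> F\<^esub> A \<in> G"
      using lift[OF xy] BA xy unfolding AB by (simp only: quotient_join quotient_imp)
  qed
qed

end

theorem proposition5p8:
  fixes X :: "('a, 'm) bounded_be_scheme"
    and F :: "'a set"
  assumes "iom_algebra X"
    and "deductive_system X F"
  shows "F \<in> DS\<^sub>c X \<longleftrightarrow> DS (X \<sslash> F) = DS\<^sub>c (X \<sslash> F)"
proof -
  interpret iom_deductive_system X F
    using assms by (simp add: iom_deductive_system_def iom_deductive_system_axioms_def)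
  show ?thesis
  proof
    assume "F \<in> DS\<^sub>c X"
    then show "DS (X \<sslash> F) = DS\<^sub>c (X \<sslash> F)"
      using quotient_ds_commutative by (auto simp: DS_def DS\<^sub>c_def commutative_ds_def)
  next
    assume "DS (X \<sslash> F) = DS\<^sub>c (X \<sslash> F)"
    then have "commutative_ds (X \<sslash> F) {\<one>\<^bsub>X \<sslash> F\<^esub>}"
      using quotient_unit_ds by (auto simp: DS_def DS\<^sub>c_def)
    then show "F \<in> DS\<^sub>c X"
      using commutative_if_quotient_unit_commutative by (simp add: DS\<^sub>c_def)
  qed
qed

end
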